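(* Fix a staggered mesh with periodic boundary conditions, $\Delta t>0$ and constants $c_0,c_h\in\mathbb{R}$, $\tau\in(0,+\infty]$, and let $(T_p^n,\mathbf{J}_c^n,\boldsymbol{\psi}_p^n,\varphi_c^n)_{n\ge0}$ satisfy the scheme $$T_p^{n+1}=T_p^n-c_0\Delta t\,\nabla_p^c\cdot\mathbf{J}_c^{n+\frac12},$$ $$\mathbf{J}_c^{n+1}=\mathbf{J}_c^n-c_0\Delta t\,\nabla_c^pT_p^{n+\frac12}-c_h\Delta t\,\nabla_c^p\times\boldsymbol{\psi}_p^{n+\frac12}-\frac{\Delta t}{\tau}\mathbf{J}_c^{n+\frac12},$$ $$\boldsymbol{\psi}_p^{n+1}=\boldsymbol{\psi}_p^n+c_h\Delta t\,\nabla_p^c\times\mathbf{J}_c^{n+\frac12}-c_h\Delta t\,\nabla_p^c\varphi_c^{n+\frac12},$$ $$\varphi_c^{n+1}=\varphi_c^n-c_h\Delta t\,\nabla_c^p\cdot\boldsymbol{\psi}_p^{n+\frac12}.$$ Let $$\mathrm{E}_{\boldsymbol{\omega}}^n=\frac12\sum_p|\Omega_p|\,\big\|\nabla_p^c\times\mathbf{J}_c^n\big\|^2+\frac12\sum_c|\Omega_c|\,\big\|\nabla_c^p\times\boldsymbol{\psi}_p^n\big\|^2$$ be the discrete rotational energy. Then: (a) if $\tau<+\infty$, it is dissipated: $$\mathrm{E}_{\boldsymbol{\omega}}^{n+1}-\mathrm{E}_{\boldsymbol{\omega}}^n=-\frac{\Delta t}{\tau}\sum_p|\Omega_p|\,\big\|\nabla_p^c\times\mathbf{J}_c^{n+\frac12}\big\|^2\le0\qquad\forall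 n\ge0;$$ (b) in the limit $\tau\to\infty$ ($1/\tau=0$), it is conserved: $\mathrm{E}_{\boldsymbol{\omega}}^n=\mathrm{E}_{\boldsymbol{\omega}}^0$ for all $n\ge0$.
   Context: Staggered mesh: the domain $\Omega$ is covered by finitely many primal cells $\Omega_c$ (indexed by $c$, centers $\mathbf{x}_c$) and by dual cells $\Omega_p$ (indexed by the primal vertices $p$, centers $\mathbf{x}_p$) obtained by connecting neighboring primal cell centers; $|\Omega_c|,|\Omega_p|>0$ are their measures. Write $p\in\Omega_c$ iff $p$ is a vertex of $\Omega_c$; this is equivalent to $c\in\Omega_p$. With periodic boundary conditions the mesh is identified periodically and there are no boundary contributions. For each incident pair $(c,p)$, $l_{pc}\mathbf{n}_{pc}$ is the corner vector: the integral of the unit normal outward to $\Omega_c$ over the part of $\partial\Omega_c$ consisting of the half-edges of $\Omega_c$ adjacent to $p$ (viewed as a vector in $\mathbb{R}^3$, with vanishing third component for two-dimensional meshes), with $l_{pc}\ge0$, and $\mathbf{n}_{cp}=-\mathbf{n}_{pc}$. One has $\sum_{p\in\Omega_c}l_{pc}\mathbf{n}_{pc}=0$ and $\sum_{c\in\Omega_p}l_{pc}\mathbf{n}_{cp}=0$. Discrete operators, for $\star$ denoting multiplication by a scalar field (gradient), scalar product $\cdot$ with a vector field (divergence), or vector product $\times$ with a vector field (curl): $$(\nabla_c^p\star f_p)_c=\frac1{|\Omega_c|}\sum_{p\in\Omega_c}l_{pc}\mathbf{n}_{pc}\star f_p,\qquad(\nabla_p^c\star f_c)_p=\frac1{|\Omega_p|}\sum_{c\in\Omega_p}l_{pc}\mathbf{n}_{cp}\star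 f_c.$$ The meshes considered are such that the compatibility identities $\nabla_c^p\times\nabla_p^c\phi_c=0$, $\nabla_p^c\times\nabla_c^p\phi_p=0$, $\nabla_c^p\cdot(\nabla_p^c\times\mathbf{A}_c)=0$, $\nabla_p^c\cdot(\nabla_c^p\times\mathbf{A}_p)=0$ hold for all discrete fields (e.g. uniform Cartesian periodic meshes). Unknowns: $T_p^n\in\mathbb{R}$ and $\boldsymbol{\psi}_p^n\in\mathbb{R}^3$ live at the vertices $p$; $\mathbf{J}_c^n\in\mathbb{R}^3$ and $\varphi_c^n\in\mathbb{R}$ live at the cell centers $c$. A superscript $n+\frac12$ denotes the average of the values at $n$ and $n+1$. $\tau=+\infty$ ($1/\tau=0$) means the relaxation term is dropped (reversible scheme). $\|\cdot\|$ is the Euclidean norm. *)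

theory Defs
  imports "HOL-Analysis.Analysis"
begin

text \<open>
  The indices of the primal cells and of the vertices are the elements of finite types \<open>'c\<close> and
  \<open>'p\<close>. The geometry of the mesh is recorded through the data that enters the discrete operators:
  \<open>vert M p c\<close> says that \<open>p\<close> is a vertex of \<open>\<Omega>\<^sub>c\<close> (equivalently, that \<open>c\<close> belongs to the dual cell
  \<open>\<Omega>\<^sub>p\<close>), \<open>meas_c\<close> and \<open>meas_p\<close> are the measures \<open>|\<Omega>\<^sub>c|\<close> and \<open>|\<Omega>\<^sub>p|\<close>, and \<open>len M p c\<close> times
  \<open>nrm M p c\<close> is the corner vector \<open>l\<^sub>p\<^sub>c n\<^sub>p\<^sub>c\<close>, with the normal pointing out of \<open>\<Omega>\<^sub>c\<close>. The values
  of \<open>len\<close> and \<open>nrm\<close> at non-incident pairs are never used.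
\<close>

record ('c, 'p) mesh =
  vert :: "'p \<Rightarrow> 'c \<Rightarrow> bool"
  meas_c :: "'c \<Rightarrow> real"
  meas_p :: "'p \<Rightarrow> real"
  len :: "'p \<Rightarrow> 'c \<Rightarrow> real"
  nrm :: "'p \<Rightarrow> 'c \<Rightarrow> real^3"

definition nrm_cp :: "('c, 'p) mesh \<Rightarrow> 'c \<Rightarrow> 'p \<Rightarrow> real^3" where
  "nrm_cp M c p = - nrm M p c"

text \<open>
  The two closure identities express that the boundary of every primal cell and of every dual cell
  is closed; under periodic identification they hold at every index, without boundary terms.
\<close>

locale staggered_mesh =
  fixes M :: "('c::finite, 'p::finite) mesh"
  assumes meas_c_pos: "0 < meas_c M c"
    and meas_p_pos: "0 < meas_p M p"
    and len_nonneg: "vert M p c \<Longrightarrow> 0 \<le> len M p c"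
    and norm_nrm: "vert M p c \<Longrightarrow> norm (nrm M p c) = 1"
    and closed_c: "(\<Sum>p | vert M p c. len M p c *\<^sub>R nrm M p c) = 0"
    and closed_p: "(\<Sum>c | vert M p c. len M p c *\<^sub>R nrm_cp M c p) = 0"

text \<open>
  The operators \<open>\<nabla>\<^sub>c\<^sup>p \<star> f\<^sub>p\<close> (vertex fields to cell fields) and \<open>\<nabla>\<^sub>p\<^sup>c \<star> f\<^sub>c\<close> (cell fields to vertex
  fields), for an arbitrary product \<open>\<star>\<close>.
\<close>

definition nabla_c ::
  "('c::finite, 'p::finite) mesh \<Rightarrow> (real^3 \<Rightarrow> 'a \<Rightarrow> 'b::real_vector) \<Rightarrow> ('p \<Rightarrow> 'a) \<Rightarrow> 'c \<Rightarrow> 'b" where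
  "nabla_c M star f c =
     (1 / meas_c M c) *\<^sub>R (\<Sum>p | vert M p c. star (len M p c *\<^sub>R nrm M p c) (f p))"

definition nabla_p ::
  "('c::finite, 'p::finite) mesh \<Rightarrow> (real^3 \<Rightarrow> 'a \<Rightarrow> 'b::real_vector) \<Rightarrow> ('c \<Rightarrow> 'a) \<Rightarrow> 'p \<Rightarrow> 'b" where
  "nabla_p M star f p =
     (1 / meas_p M p) *\<^sub>R (\<Sum>c | vert M p c. star (len M p c *\<^sub>R nrm_cp M c p) (f c))"

abbreviation grad_c :: "('c::finite, 'p::finite) mesh \<Rightarrow> ('p \<Rightarrow> real) \<Rightarrow> 'c \<Rightarrow> real^3" where
  "grad_c M \<equiv> nabla_c M (\<lambda>v a. a *\<^sub>R v)"

abbreviation div_c :: "('c::finite, 'p::finite) mesh \<Rightarrow> ('p \<Rightarrow> real^3) \<Rightarrow> 'c \<Rightarrow> real" where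
  "div_c M \<equiv> nabla_c M (\<lambda>v w. v \<bullet> w)"

abbreviation curl_c :: "('c::finite, 'p::finite) mesh \<Rightarrow> ('p \<Rightarrow> real^3) \<Rightarrow> 'c \<Rightarrow> real^3" where
  "curl_c M \<equiv> nabla_c M (\<lambda>v w. cross3 v w)"

abbreviation grad_p :: "('c::finite, 'p::finite) mesh \<Rightarrow> ('c \<Rightarrow> real) \<Rightarrow> 'p \<Rightarrow> real^3" where
  "grad_p M \<equiv> nabla_p M (\<lambda>v a. a *\<^sub>R v)"

abbreviation div_p :: "('c::finite, 'p::finite) mesh \<Rightarrow> ('c \<Rightarrow> real^3) \<Rightarrow> 'p \<Rightarrow> real" where
  "div_p M \<equiv> nabla_p M (\<lambda>v w. v \<bullet> w)"

abbreviation curl_p :: "('c::finite, 'p::finite) mesh \<Rightarrow> ('c \<Rightarrow> real^3) \<Rightarrow> 'p \<Rightarrow> real^3" where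
  "curl_p M \<equiv> nabla_p M (\<lambda>v w. cross3 v w)"

locale compatible_staggered_mesh = staggered_mesh M
  for M :: "('c::finite, 'p::finite) mesh" +
  assumes curl_c_grad_p: "curl_c M (grad_p M \<phi>) c = 0"
    and curl_p_grad_c: "curl_p M (grad_c M \<theta>) p = 0"
    and div_c_curl_p: "div_c M (curl_p M A) c = 0"
    and div_p_curl_c: "div_p M (curl_c M B) p = 0"

text \<open>\<open>midpt u n\<close> is the field \<open>u\<^sup>n\<^sup>+\<^sup>1\<^sup>/\<^sup>2\<close>.\<close>

definition midpt :: "(nat \<Rightarrow> 'i \<Rightarrow> 'a::real_vector) \<Rightarrow> nat \<Rightarrow> 'i \<Rightarrow> 'a" where
  "midpt u n i = (1/2) *\<^sub>R (u n i + u (Suc n) i)"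

definition rot_energy ::
  "('c::finite, 'p::finite) mesh \<Rightarrow> ('c \<Rightarrow> real^3) \<Rightarrow> ('p \<Rightarrow> real^3) \<Rightarrow> real" where
  "rot_energy M J \<psi> =
     1/2 * (\<Sum>p\<in>UNIV. meas_p M p * (norm (curl_p M J p))\<^sup>2)
   + 1/2 * (\<Sum>c\<in>UNIV. meas_c M c * (norm (curl_c M \<psi> c))\<^sup>2)"

text \<open>
  A solution of the scheme. The relaxation time \<open>\<tau>\<close> is an extended real, with \<open>1 / \<infinity> = 0\<close>.
\<close>

definition scheme_solution ::
  "('c::finite, 'p::finite) mesh \<Rightarrow> real \<Rightarrow> real \<Rightarrow> real \<Rightarrow> ereal \<Rightarrow>
   (nat \<Rightarrow> 'p \<Rightarrow> real) \<Rightarrow> (nat \<Rightarrow> 'c \<Rightarrow> real^3) \<Rightarrow> (nat \<Rightarrow> 'p \<Rightarrow> real^3) \<Rightarrow> (nat \<Rightarrow> 'c \<Rightarrow> real) \<Rightarrow> bool"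
  where
  "scheme_solution M \<Delta>t c0 ch \<tau> T J \<psi> \<phi> \<longleftrightarrow>
     (\<forall>n p. T (Suc n) p = T n p - c0 * \<Delta>t * div_p M (midpt J n) p) \<and>
     (\<forall>n c. J (Suc n) c = J n c - (c0 * \<Delta>t) *\<^sub>R grad_c M (midpt T n) c
              - (ch * \<Delta>t) *\<^sub>R curl_c M (midpt \<psi> n) c
              - (\<Delta>t * real_of_ereal (1 / \<tau>)) *\<^sub>R midpt J n c) \<and>
     (\<forall>n p. \<psi> (Suc n) p = \<psi> n p + (ch * \<Delta>t) *\<^sub>R curl_p M (midpt J n) p
              - (ch * \<Delta>t) *\<^sub>R grad_p M (midpt \<phi> n) p) \<and>
     (\<forall>n c. \<phi> (Suc n) c = \<phi> n c - ch * \<Delta>t * div_c M (midpt \<psi> n) c)"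

end

theory Submission
  imports Defs
begin

text \<open>
  The curls of the scheme form a closed system: compatibility removes both gradients, so that
  \<open>\<omega> = \<nabla>\<^sub>p\<^sup>c \<times> J\<close> is driven only by \<open>\<nabla>\<^sub>p\<^sup>c \<times> \<zeta>\<close> and the relaxation, and \<open>\<zeta> = \<nabla>\<^sub>c\<^sup>p \<times> \<psi>\<close> only
  by \<open>\<nabla>\<^sub>c\<^sup>p \<times> \<omega>\<close>. Pairing the increments with the midpoint values gives the increment of the energy,
  and the two coupling terms cancel because the discrete curls are adjoint to each other for the
  inner products weighted by the cell measures.
\<close>

lemma curl_c_add: "curl_c M (\<lambda>p. f p + g p) c = curl_c M f c + curl_c M g c"
  by (simp add: nabla_c_def cross_add_right sum.distrib scaleR_add_right)

lemma curl_c_diff: "curl_c M (\<lambda>p. f p - g p) c = curl_c M f c - curl_c M g c"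
  by (simp add: nabla_c_def Cross3.right_diff_distrib sum_subtractf scaleR_diff_right)

lemma curl_c_scaleR: "curl_c M (\<lambda>p. a *\<^sub>R f p) c = a *\<^sub>R curl_c M f c"
  by (simp add: nabla_c_def cross_mult_right scaleR_sum_right mult_ac)

lemma curl_p_add: "curl_p M (\<lambda>c. f c + g c) p = curl_p M f p + curl_p M g p"
  by (simp add: nabla_p_def cross_add_right sum.distrib scaleR_add_right)

lemma curl_p_diff: "curl_p M (\<lambda>c. f c - g c) p = curl_p M f p - curl_p M g p"
  by (simp add: nabla_p_def Cross3.right_diff_distrib sum_subtractf scaleR_diff_right)

lemma curl_p_scaleR: "curl_p M (\<lambda>c. a *\<^sub>R f c) p = a *\<^sub>R curl_p M f p"
  by (simp add: nabla_p_def cross_mult_right scaleR_sum_right mult_ac)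

text \<open>The curl is linear, so it commutes with averaging in time. The right-hand side is thus
  again a \<open>midpt\<close>, now of the sequence of curls, to which a difference-of-squares
  identity can be applied.\<close>

lemma curl_c_midpt: "curl_c M (midpt u n) = midpt (\<lambda>n. curl_c M (u n)) n"
proof
  show "curl_c M (midpt u n) c = midpt (\<lambda>n. curl_c M (u n)) n c" for c
    unfolding midpt_def [abs_def] by (simp only: curl_c_scaleR curl_c_add)
qed

lemma curl_p_midpt: "curl_p M (midpt u n) = midpt (\<lambda>n. curl_p M (u n)) n"
proof
  show "curl_p M (midpt u n) p = midpt (\<lambda>n. curl_p M (u n)) n p" for p
    unfolding midpt_def [abs_def] by (simp only: curl_p_scaleR curl_p_add)
qed

text \<open>The difference of squares is the inner product of sum and difference, and the sum is
  twice the midpoint. This is why midpoint averaging gives an exact increment, with no remainder in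
  the time step.\<close>

lemma norm_power2_diff_midpt:
  fixes u :: "nat \<Rightarrow> 'i \<Rightarrow> 'a::real_inner"
  shows "(norm (u (Suc n) i))\<^sup>2 - (norm (u n i))\<^sup>2 = 2 * (midpt u n i \<bullet> (u (Suc n) i - u n i))"
  by (simp add: midpt_def power2_norm_eq_inner algebra_simps inner_commute)

text \<open>The measures cancel the prefactors of the operators, leaving on both sides a sum of
  triple products over incident pairs. Two signs cancel: one from exchanging \<open>w\<close> and
  \<open>z\<close> in the triple product, one from \<open>nrm_cp\<close> being the opposite of
  \<open>nrm\<close>.\<close>

lemma (in staggered_mesh) curl_adjoint:
  "(\<Sum>p\<in>UNIV. meas_p M p * (w p \<bullet> curl_p M z p))
     = (\<Sum>c\<in>UNIV. meas_c M c * (z c \<bullet> curl_c M w c))"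
proof -
  \<comment> \<open>Zero at non-incident pairs extends the sum to all cells, so that the two orders
    of summation can be swapped.\<close>
  have p: "meas_p M p * (w p \<bullet> curl_p M z p)
      = (\<Sum>c\<in>UNIV. if vert M p c then z c \<bullet> cross3 (len M p c *\<^sub>R nrm M p c) (w p) else 0)" for p
  proof -
    have "meas_p M p * (w p \<bullet> curl_p M z p)
        = (\<Sum>c | vert M p c. w p \<bullet> cross3 (len M p c *\<^sub>R nrm_cp M c p) (z c))"
      using meas_p_pos[of p] by (simp add: nabla_p_def inner_sum_right)
    also have "\<dots> = (\<Sum>c | vert M p c. z c \<bullet> cross3 (len M p c *\<^sub>R nrm M p c) (w p))"
    proof (rule sum.cong)
      fix c
      show "w p \<bullet> cross3 (len M p c *\<^sub>R nrm_cp M c p) (z c)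
          = z c \<bullet> cross3 (len M p c *\<^sub>R nrm M p c) (w p)"
        by (simp add: nrm_cp_def cross3_def inner_vec_def sum_3 algebra_simps)
    qed simp
    finally show ?thesis by (simp add: sum.If_cases)
  qed
  have c: "meas_c M c * (z c \<bullet> curl_c M w c)
      = (\<Sum>p\<in>UNIV. if vert M p c then z c \<bullet> cross3 (len M p c *\<^sub>R nrm M p c) (w p) else 0)" for c
    using meas_c_pos[of c] by (simp add: nabla_c_def inner_sum_right sum.If_cases)
  show ?thesis unfolding p c by (rule sum.swap)
qed

text \<open>A pointwise identity for arbitrary sequences, summed with the measures as weights; the
  scheme enters only when the increments of the curls are replaced.\<close>

lemma rot_energy_diff:
  "rot_energy M (J (Suc n)) (\<psi> (Suc n)) - rot_energy M (J n) (\<psi> n)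
     = (\<Sum>p\<in>UNIV. meas_p M p *
         (curl_p M (midpt J n) p \<bullet> (curl_p M (J (Suc n)) p - curl_p M (J n) p)))
     + (\<Sum>c\<in>UNIV. meas_c M c *
         (curl_c M (midpt \<psi> n) c \<bullet> (curl_c M (\<psi> (Suc n)) c - curl_c M (\<psi> n) c)))"
proof -
  have weighted: "m * (x \<bullet> d) = 1/2 * (m * a) - 1/2 * (m * b)" if "a - b = 2 * (x \<bullet> d)"
    for m a b :: real and x d :: "real^3"
  proof -
    have "x \<bullet> d = (a - b) / 2" using that by simp
    then show ?thesis by (simp only:) (simp add: field_simps)
  qed
  have p: "meas_p M p * (curl_p M (midpt J n) p \<bullet> (curl_p M (J (Suc n)) p - curl_p M (J n) p))
      = 1/2 * (meas_p M p * (norm (curl_p M (J (Suc n)) p))\<^sup>2)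
        - 1/2 * (meas_p M p * (norm (curl_p M (J n) p))\<^sup>2)" for p
    unfolding curl_p_midpt by (rule weighted) (rule norm_power2_diff_midpt)
  have c: "meas_c M c * (curl_c M (midpt \<psi> n) c \<bullet> (curl_c M (\<psi> (Suc n)) c - curl_c M (\<psi> n) c))
      = 1/2 * (meas_c M c * (norm (curl_c M (\<psi> (Suc n)) c))\<^sup>2)
        - 1/2 * (meas_c M c * (norm (curl_c M (\<psi> n) c))\<^sup>2)" for c
    unfolding curl_c_midpt by (rule weighted) (rule norm_power2_diff_midpt)
  show ?thesis
    unfolding p c rot_energy_def sum_subtractf sum_distrib_left by simp
qed

text \<open>Keeping the coefficient as \<open>real_of_ereal (1 / \<tau>)\<close> lets one formula
  serve both the relaxed and the reversible scheme.\<close>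

lemma (in compatible_staggered_mesh) rot_energy_balance:
  assumes "scheme_solution M \<Delta>t c0 ch \<tau> T J \<psi> \<phi>"
  shows "rot_energy M (J (Suc n)) (\<psi> (Suc n)) - rot_energy M (J n) (\<psi> n)
     = - (\<Delta>t * real_of_ereal (1 / \<tau>))
         * (\<Sum>p\<in>UNIV. meas_p M p * (norm (curl_p M (midpt J n) p))\<^sup>2)"
proof -
  define k where "k = ch * \<Delta>t"
  define r where "r = \<Delta>t * real_of_ereal (1 / \<tau>)"
  define w where "w = curl_p M (midpt J n)"
  define z where "z = curl_c M (midpt \<psi> n)"
  \<comment> \<open>The updates are needed as equalities of whole fields, since the curl is applied
    to them.\<close>
  have J: "J (Suc n) = (\<lambda>c. J n c - (c0 * \<Delta>t) *\<^sub>R grad_c M (midpt T n) c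
              - k *\<^sub>R z c - r *\<^sub>R midpt J n c)"
    and \<psi>: "\<psi> (Suc n) = (\<lambda>p. \<psi> n p + k *\<^sub>R w p - k *\<^sub>R grad_p M (midpt \<phi> n) p)"
    using assms unfolding scheme_solution_def k_def r_def w_def z_def by blast+
  have p: "curl_p M (J (Suc n)) p - curl_p M (J n) p = - (k *\<^sub>R curl_p M z p) - r *\<^sub>R w p" for p
    unfolding J curl_p_diff curl_p_scaleR curl_p_grad_c w_def [symmetric] by simp
  have c: "curl_c M (\<psi> (Suc n)) c - curl_c M (\<psi> n) c = k *\<^sub>R curl_c M w c" for c
    unfolding \<psi> curl_c_diff curl_c_add curl_c_scaleR curl_c_grad_p by simp
  have "rot_energy M (J (Suc n)) (\<psi> (Suc n)) - rot_energy M (J n) (\<psi> n)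
      = (\<Sum>p\<in>UNIV. meas_p M p * (w p \<bullet> (- (k *\<^sub>R curl_p M z p) - r *\<^sub>R w p)))
        + (\<Sum>c\<in>UNIV. meas_c M c * (z c \<bullet> (k *\<^sub>R curl_c M w c)))"
    unfolding rot_energy_diff p c w_def [symmetric] z_def [symmetric] ..
  also have "\<dots> = - k * (\<Sum>p\<in>UNIV. meas_p M p * (w p \<bullet> curl_p M z p))
        - r * (\<Sum>p\<in>UNIV. meas_p M p * (norm (w p))\<^sup>2)
        + k * (\<Sum>c\<in>UNIV. meas_c M c * (z c \<bullet> curl_c M w c))"
    by (simp add: power2_norm_eq_inner inner_diff_right sum_distrib_left sum_subtractf
        sum_negf right_diff_distrib mult_ac)
  \<comment> \<open>By adjointness the first and third sums agree, and they carry the opposite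
    coefficients \<open>- k\<close> and \<open>k\<close>.\<close>
  also have "\<dots> = - r * (\<Sum>p\<in>UNIV. meas_p M p * (norm (w p))\<^sup>2)"
    unfolding curl_adjoint by simp
  finally show ?thesis unfolding r_def w_def .
qed

theorem theorem4p3:
  fixes M :: "('c::finite, 'p::finite) mesh"
    and \<Delta>t c0 ch :: real and \<tau> :: ereal
    and T :: "nat \<Rightarrow> 'p \<Rightarrow> real" and J :: "nat \<Rightarrow> 'c \<Rightarrow> real^3"
    and \<psi> :: "nat \<Rightarrow> 'p \<Rightarrow> real^3" and \<phi> :: "nat \<Rightarrow> 'c \<Rightarrow> real"
  assumes "compatible_staggered_mesh M"
    and "0 < \<Delta>t" and "0 < \<tau>"
    and "scheme_solution M \<Delta>t c0 ch \<tau> T J \<psi> \<phi>"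
  shows "(\<tau> < \<infinity> \<longrightarrow> (\<forall>n.
            rot_energy M (J (Suc n)) (\<psi> (Suc n)) - rot_energy M (J n) (\<psi> n)
              = - (\<Delta>t / real_of_ereal \<tau>)
                  * (\<Sum>p\<in>UNIV. meas_p M p * (norm (curl_p M (midpt J n) p))\<^sup>2)
          \<and> - (\<Delta>t / real_of_ereal \<tau>)
                  * (\<Sum>p\<in>UNIV. meas_p M p * (norm (curl_p M (midpt J n) p))\<^sup>2) \<le> 0))
       \<and> (\<tau> = \<infinity> \<longrightarrow> (\<forall>n.
            rot_energy M (J n) (\<psi> n) = rot_energy M (J 0) (\<psi> 0)))"
proof -
  interpret compatible_staggered_mesh M by fact
  note balance = rot_energy_balance [OF assms(4)]
  define D where "D n = (\<Sum>p\<in>UNIV. meas_p M p * (norm (curl_p M (midpt J n) p))\<^sup>2)" for n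
  have D_nonneg: "0 \<le> D n" for n
    unfolding D_def by (intro sum_nonneg mult_nonneg_nonneg) (simp_all add: meas_p_pos less_imp_le)
  have finite_case: "rot_energy M (J (Suc n)) (\<psi> (Suc n)) - rot_energy M (J n) (\<psi> n)
        = - (\<Delta>t / real_of_ereal \<tau>) * D n \<and> - (\<Delta>t / real_of_ereal \<tau>) * D n \<le> 0"
    if "\<tau> < \<infinity>" for n
  proof -
    \<comment> \<open>Positivity excludes minus infinity, so \<tau> is a positive real and the
      extended division is the real one.\<close>
    obtain t where t: "\<tau> = ereal t" "0 < t"
      using \<open>\<tau> < \<infinity>\<close> \<open>0 < \<tau>\<close> by (cases \<tau>) auto
    then have "real_of_ereal (1 / \<tau>) = 1 / t" by (simp add: one_ereal_def)
    moreover have "0 \<le> \<Delta>t / t * D n" using \<open>0 < \<Delta>t\<close> t D_nonneg[of n] by simp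
    ultimately show ?thesis using balance[of n] t by (simp add: D_def)
  qed
  \<comment> \<open>Here \<open>1 / \<tau>\<close> is zero, so the balance makes every single
    increment vanish.\<close>
  have infinite_case: "rot_energy M (J n) (\<psi> n) = rot_energy M (J 0) (\<psi> 0)" if "\<tau> = \<infinity>" for n
  proof (induction n)
    case (Suc n)
    then show ?case using balance[of n] that by simp
  qed simp
  show ?thesis using finite_case infinite_case unfolding D_def by blast
qed

end
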